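(* Let $K$ be a field with $\mathrm{char}(K)=0$, let $q_1,q_2,q_3,q_4\in K$ with $q_1\neq 0$, and let $A$ be the $K$-algebra generated by $x,y$ subject to the single relation $yx=q_1xy+q_2x+q_3y+q_4$. Let $Z(A)$ denote the center of $A$. (i) Suppose $q_2=q_3=0$. If $q_1$ is not a root of unity, or if $q_1=1$ and $q_4\neq 0$, then $Z(A)=K$. If $q_1$ is a root of unity of degree $n\geq 2$, then $Z(A)=K[x^n,y^n]$. (ii) Suppose $q_2\neq 0$ or $q_3\neq 0$. If $q_1$ is not a root of unity, or if $q_1=1$, then $Z(A)=K$. If $q_1$ is a root of unity of degree $n\geq 2$, then there exist polynomials $f,g$ in one variable over $K$ with $\deg(f)=\deg(g)=n$ such that $Z(A)=K[f(x),g(y)]$.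
   Context: $A$ is the quotient of the free associative $K$-algebra on $x,y$ by the two-sided ideal generated by the given relation; elements of $K$ commute with $x$ and $y$, and the monomials $x^iy^j$ ($i,j\ge 0$) form a $K$-basis of $A$. "$q$ is a root of unity of degree $n$" means that $q$ is a primitive $n$-th root of unity (its multiplicative order is exactly $n$). $K[a,b]$ denotes the $K$-subalgebra of $A$ generated by the elements $a,b$. *)

theory Defs
  imports
    "HOL-Algebra.Algebra"
    "HOL-Algebra.Algebraic_Closure_Type"
    "HOL-Library.Poly_Mapping"
    "HOL-Computational_Algebra.Polynomial"
begin

section \<open>The free associative algebra\<close>

text \<open>
  A wrapper around lists, so that words can be written additively: the convolution product
  of \<^theory>\<open>HOL-Library.Poly_Mapping\<close> takes its monoid of exponents in class
  \<^class>\<open>monoid_add\<close>.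
\<close>

datatype 'g free_word = Word (letters: "'g list")

instantiation free_word :: (type) monoid_add
begin

definition zero_free_word :: "'a free_word"
  where "0 = Word []"

definition plus_free_word :: "'a free_word \<Rightarrow> 'a free_word \<Rightarrow> 'a free_word"
  where "u + v = Word (letters u @ letters v)"

instance
  by standard (simp_all add: zero_free_word_def plus_free_word_def)

end

text \<open>The monoid algebra over \<open>'k\<close> of the free monoid on \<open>'g\<close>.\<close>

type_synonym ('g, 'k) free_algebra = "'g free_word \<Rightarrow>\<^sub>0 'k"

definition free_scalar :: "'k \<Rightarrow> ('g, 'k::field) free_algebra"
  where "free_scalar c = Poly_Mapping.single 0 c"

definition free_var :: "'g \<Rightarrow> ('g, 'k::field) free_algebra"
  where "free_var g = Poly_Mapping.single (Word [g]) 1"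

definition free_ring :: "('g, 'k::field) free_algebra ring"
  where "free_ring = ring_of_type_algebra"


section \<open>The algebra with relation \<open>yx = q1 xy + q2 x + q3 y + q4\<close>\<close>

datatype gen_xy = GenX | GenY

definition quad_relator :: "'k \<Rightarrow> 'k \<Rightarrow> 'k \<Rightarrow> 'k \<Rightarrow> (gen_xy, 'k::field) free_algebra"
  where "quad_relator q1 q2 q3 q4 =
    free_var GenY * free_var GenX
      - (free_scalar q1 * free_var GenX * free_var GenY + free_scalar q2 * free_var GenX
          + free_scalar q3 * free_var GenY + free_scalar q4)"

text \<open>HOL-Algebra's \<^const>\<open>genideal\<close> is the generated two-sided ideal.\<close>

definition quad_ideal :: "'k \<Rightarrow> 'k \<Rightarrow> 'k \<Rightarrow> 'k \<Rightarrow> (gen_xy, 'k::field) free_algebra set"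
  where "quad_ideal q1 q2 q3 q4 = genideal free_ring {quad_relator q1 q2 q3 q4}"

definition quad_algebra ::
    "'k \<Rightarrow> 'k \<Rightarrow> 'k \<Rightarrow> 'k \<Rightarrow> (gen_xy, 'k::field) free_algebra set ring"
  where "quad_algebra q1 q2 q3 q4 = free_ring Quot (quad_ideal q1 q2 q3 q4)"

definition quad_class ::
    "'k \<Rightarrow> 'k \<Rightarrow> 'k \<Rightarrow> 'k \<Rightarrow> (gen_xy, 'k::field) free_algebra \<Rightarrow> (gen_xy, 'k) free_algebra set"
  where "quad_class q1 q2 q3 q4 p = quad_ideal q1 q2 q3 q4 +>\<^bsub>free_ring\<^esub> p"

definition quad_x :: "'k \<Rightarrow> 'k \<Rightarrow> 'k \<Rightarrow> 'k \<Rightarrow> (gen_xy, 'k::field) free_algebra set"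
  where "quad_x q1 q2 q3 q4 = quad_class q1 q2 q3 q4 (free_var GenX)"

definition quad_y :: "'k \<Rightarrow> 'k \<Rightarrow> 'k \<Rightarrow> 'k \<Rightarrow> (gen_xy, 'k::field) free_algebra set"
  where "quad_y q1 q2 q3 q4 = quad_class q1 q2 q3 q4 (free_var GenY)"

definition quad_scalar :: "'k \<Rightarrow> 'k \<Rightarrow> 'k \<Rightarrow> 'k \<Rightarrow> 'k \<Rightarrow> (gen_xy, 'k::field) free_algebra set"
  where "quad_scalar q1 q2 q3 q4 c = quad_class q1 q2 q3 q4 (free_scalar c)"


section \<open>Centre, generated subalgebras, evaluation, roots of unity\<close>

definition ring_center :: "('a, 'b) ring_scheme \<Rightarrow> 'a set"
  where "ring_center R =
    {z \<in> carrier R. \<forall>a \<in> carrier R. z \<otimes>\<^bsub>R\<^esub> a = a \<otimes>\<^bsub>R\<^esub> z}"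

text \<open>
  The smallest unital subring of \<open>R\<close> that contains \<open>S\<close> and is stable under the scalars \<open>K\<close>
  (a subset of \<open>R\<close>); with \<open>S = {a, b}\<close> this is \<open>K[a, b]\<close>. The library's locale
  \<^locale>\<open>subalgebra\<close> only says that \<open>V\<close> is a \<open>K\<close>-submodule of \<open>R\<close>, hence the extra \<^const>\<open>subring\<close>.
\<close>

definition generated_subalgebra :: "'a set \<Rightarrow> ('a, 'b) ring_scheme \<Rightarrow> 'a set \<Rightarrow> 'a set"
  where "generated_subalgebra K R S = \<Inter> {V. subring V R \<and> subalgebra K V R \<and> S \<subseteq> V}"

text \<open>
  The value at \<open>a\<close> of \<open>f\<close>, with coefficients transported by the structure map \<open>\<iota>\<close>. Since
  \<open>R\<close> need not be commutative, the library's \<^const>\<open>poly\<close> is not applicable.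
\<close>

definition eval_poly_in ::
    "('a, 'b) ring_scheme \<Rightarrow> ('k \<Rightarrow> 'a) \<Rightarrow> 'k::field Polynomial.poly \<Rightarrow> 'a \<Rightarrow> 'a"
  where "eval_poly_in R \<iota> f a =
    (\<Oplus>\<^bsub>R\<^esub>i \<in> {..Polynomial.degree f}. \<iota> (Polynomial.coeff f i) \<otimes>\<^bsub>R\<^esub> (a [^]\<^bsub>R\<^esub> i))"

definition root_of_unity :: "'k::field \<Rightarrow> bool"
  where "root_of_unity q \<longleftrightarrow> (\<exists>n::nat. n \<ge> 1 \<and> q ^ n = 1)"

definition primitive_root_of_unity :: "nat \<Rightarrow> 'k::field \<Rightarrow> bool"
  where "primitive_root_of_unity n q \<longleftrightarrow>
    n \<ge> 1 \<and> q ^ n = 1 \<and> (\<forall>m. 1 \<le> m \<and> m < n \<longrightarrow> q ^ m \<noteq> 1)"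


section \<open>The presentation\<close>

lemma free_ring_ring: "ring (free_ring :: ('g, 'k::field) free_algebra ring)"
proof -
  have "\<exists>y. x + y = 0" for x :: "('g, 'k) free_algebra"
    using add.right_inverse by blast
  then show ?thesis
    unfolding free_ring_def ring_of_type_algebra_def using add.right_inverse
    by unfold_locales (auto simp: algebra_simps Units_def)
qed

lemma quad_ideal_ideal: "ideal (quad_ideal q1 q2 q3 q4) free_ring"
  unfolding quad_ideal_def
  by (rule ring.genideal_ideal[OF free_ring_ring]) (simp add: free_ring_def ring_of_type_algebra_def)

lemma quad_algebra_ring: "ring (quad_algebra q1 q2 q3 q4)"
  unfolding quad_algebra_def by (rule ideal.quotient_is_ring[OF quad_ideal_ideal])

lemma quad_class_hom:
  "quad_class q1 q2 q3 q4 \<in> ring_hom free_ring (quad_algebra q1 q2 q3 q4)"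
  using ideal.rcos_ring_hom[OF quad_ideal_ideal, of q1 q2 q3 q4]
  by (simp add: quad_algebra_def quad_class_def[abs_def])

lemma quad_algebra_relation:
  fixes q1 q2 q3 q4 :: "'k::field"
  defines "A \<equiv> quad_algebra q1 q2 q3 q4"
    and "x \<equiv> quad_x q1 q2 q3 q4" and "y \<equiv> quad_y q1 q2 q3 q4"
    and "s \<equiv> quad_scalar q1 q2 q3 q4"
  shows "y \<otimes>\<^bsub>A\<^esub> x =
    s q1 \<otimes>\<^bsub>A\<^esub> x \<otimes>\<^bsub>A\<^esub> y \<oplus>\<^bsub>A\<^esub> s q2 \<otimes>\<^bsub>A\<^esub> x \<oplus>\<^bsub>A\<^esub> s q3 \<otimes>\<^bsub>A\<^esub> y \<oplus>\<^bsub>A\<^esub> s q4"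
proof -
  let ?F = "free_ring :: (gen_xy, 'k) free_algebra ring"
  let ?c = "quad_class q1 q2 q3 q4" and ?I = "quad_ideal q1 q2 q3 q4"
  let ?l = "free_var GenY * free_var GenX :: (gen_xy, 'k) free_algebra"
  let ?r = "free_scalar q1 * free_var GenX * free_var GenY + free_scalar q2 * free_var GenX
          + free_scalar q3 * free_var GenY + free_scalar q4 :: (gen_xy, 'k) free_algebra"
  have F: "carrier ?F = UNIV" "\<And>a b. a \<otimes>\<^bsub>?F\<^esub> b = a * b" "\<And>a b. a \<oplus>\<^bsub>?F\<^esub> b = a + b"
    by (simp_all add: free_ring_def ring_of_type_algebra_def)
  interpret I: ideal ?I ?F by (rule quad_ideal_ideal)
  have mult: "?c (a * b) = ?c a \<otimes>\<^bsub>A\<^esub> ?c b" and add: "?c (a + b) = ?c a \<oplus>\<^bsub>A\<^esub> ?c b" for a b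
    using ring_hom_mult[OF quad_class_hom[of q1 q2 q3 q4], of a b]
      ring_hom_add[OF quad_class_hom[of q1 q2 q3 q4], of a b] by (simp_all add: F A_def)
  have rel: "quad_relator q1 q2 q3 q4 \<in> ?I"
    unfolding quad_ideal_def by (rule ring.genideal_self'[OF free_ring_ring]) (simp add: F)
  have "?l = quad_relator q1 q2 q3 q4 + ?r"
    by (simp add: quad_relator_def)
  then have "?l \<in> ?I +>\<^bsub>?F\<^esub> ?r"
    using rel by (auto simp: a_r_coset_def' F)
  then have "?c ?l = ?c ?r"
    unfolding quad_class_def by (metis I.a_repr_independence' F(1) UNIV_I)
  then show ?thesis
    by (simp only: mult add x_def y_def s_def quad_x_def quad_y_def quad_scalar_def)
qed

end

theory Submission
  imports Defs
begin

text \<open>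
  Suitable new generators \<open>X\<close>, \<open>Y\<close> satisfy \<open>YX = q XY + a X + c\<close> with \<open>a = 0\<close>, or with \<open>q = 1\<close> and
  \<open>c = 0\<close>: for \<open>q1 \<noteq> 1\<close> shift \<open>x\<close> and \<open>y\<close> by constants, and for \<open>q1 = 1\<close> take the commutator of \<open>x\<close> and
  \<open>y\<close> as \<open>X\<close>, unless it is a scalar. The algebra acts on the space of coefficient arrays by left
  multiplication, which shows that the monomials \<open>X^i Y^j\<close> are linearly independent. If \<open>a = 0\<close> and
  \<open>z\<close> is central with coefficients \<open>m(i, j)\<close>, comparing coefficients in \<open>zX = Xz\<close> and \<open>zY = Yz\<close> gives
  \<open>(1 - q^j) m(i, j) = c [j + 1] m(i + 1, j + 1)\<close> and \<open>(1 - q^i) m(i, j) = c [i + 1] m(i + 1, j + 1)\<close>,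
  where \<open>[k] = 1 + q + \<dots> + q^(k - 1)\<close>. For \<open>q \<noteq> 1\<close>, going up a diagonal shows that \<open>m(i, j) \<noteq> 0\<close>
  forces \<open>q^i = q^j = 1\<close>: the chain stops at the latest when \<open>q^(j + 1) = 1\<close>, where \<open>[j + 1] = 0\<close>.
  For \<open>q = 1\<close> and \<open>c \<noteq> 0\<close>, the same comparison leaves only \<open>m(0, 0)\<close> in characteristic \<open>0\<close>. For
  \<open>q = 1\<close> and \<open>a \<noteq> 0\<close>, a central element is a polynomial \<open>b(Y)\<close> with \<open>b(Y + a) = b(Y)\<close>, hence constant.
\<close>


section \<open>The free algebra\<close>

lemma free_algebra_induct [case_names single add]:
  fixes p :: "('g, 'k::field) free_algebra"
  assumes single: "\<And>w c. P (Poly_Mapping.single w c)"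
    and add: "\<And>p q. P p \<Longrightarrow> P q \<Longrightarrow> P (p + q)"
  shows "P p"
proof -
  have "P (\<Sum>w\<in>W. Poly_Mapping.single w (Poly_Mapping.lookup p w))" if "finite W" for W
    using that
  proof induction
    case empty
    have "P (Poly_Mapping.single 0 0)" by (rule single)
    then show ?case by simp
  qed (simp add: single add)
  moreover have "p = (\<Sum>w\<in>Poly_Mapping.keys p. Poly_Mapping.single w (Poly_Mapping.lookup p w))"
    by (rule poly_mapping_eqI)
      (auto simp: lookup_sum lookup_single when_def not_in_keys_iff_lookup_eq_zero)
  ultimately show ?thesis by (metis finite_keys)
qed

lemma free_scalar_add: "free_scalar (a + b) = (free_scalar a + free_scalar b :: ('g, 'k::field) free_algebra)"
  and free_scalar_diff: "free_scalar (a - b) = (free_scalar a - free_scalar b :: ('g, 'k) free_algebra)"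
  and free_scalar_uminus: "free_scalar (- a) = (- free_scalar a :: ('g, 'k) free_algebra)"
  and free_scalar_mult: "free_scalar (a * b) = (free_scalar a * free_scalar b :: ('g, 'k) free_algebra)"
  by (simp_all add: free_scalar_def single_add single_diff single_uminus mult_single)

lemma free_scalar_0 [simp]: "free_scalar 0 = 0" and free_scalar_1 [simp]: "free_scalar 1 = 1"
  by (simp_all add: free_scalar_def)

lemma free_scalar_commute: "p * free_scalar c = free_scalar c * p"
  by (induction p rule: free_algebra_induct)
    (simp_all add: free_scalar_def mult_single algebra_simps)

lemma free_scalar_left_commute: "p * (free_scalar c * r) = free_scalar c * (p * r)"
  by (metis free_scalar_commute mult.assoc)

lemmas free_scalar_simps =
  free_scalar_commute[of "free_var g" for g] free_scalar_left_commute[of "free_var g" for g]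
  free_scalar_commute[of "free_scalar b" for b] free_scalar_left_commute[of "free_scalar b" for b]
  free_scalar_add free_scalar_diff free_scalar_uminus free_scalar_mult

text \<open>This is a unital subalgebra: negatives come from the scalar \<open>- 1\<close>. A
  property that cuts out such a set needs checking only on generators.\<close>

definition scalar_subring :: "('g, 'k::field) free_algebra set \<Rightarrow> bool"
  where "scalar_subring S \<longleftrightarrow>
    range free_scalar \<subseteq> S \<and> (\<forall>p\<in>S. \<forall>r\<in>S. p + r \<in> S \<and> p * r \<in> S)"

lemma scalar_subringI:
  assumes "\<And>c. free_scalar c \<in> S" "\<And>p r. p \<in> S \<Longrightarrow> r \<in> S \<Longrightarrow> p + r \<in> S"
    "\<And>p r. p \<in> S \<Longrightarrow> r \<in> S \<Longrightarrow> p * r \<in> S"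
  shows "scalar_subring S"
  using assms by (auto simp: scalar_subring_def)

lemma scalar_subringD:
  assumes "scalar_subring S"
  shows "free_scalar c \<in> S" "p \<in> S \<Longrightarrow> r \<in> S \<Longrightarrow> p + r \<in> S" "p \<in> S \<Longrightarrow> r \<in> S \<Longrightarrow> p * r \<in> S"
  using assms by (auto simp: scalar_subring_def)

lemma scalar_subring_diff:
  assumes "scalar_subring S" "p \<in> S" "r \<in> S"
  shows "p - r \<in> S"
proof -
  have "p - r = p + free_scalar (- 1) * r" by (simp add: free_scalar_uminus)
  then show ?thesis by (simp only: scalar_subringD[OF assms(1)] assms)
qed

lemma scalar_subring_power:
  assumes "scalar_subring S" "p \<in> S"
  shows "p ^ n \<in> S"
proof (induction n)
  case 0
  show ?case using scalar_subringD(1)[OF assms(1), of 1] by simp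
next
  case (Suc n)
  then show ?case using scalar_subringD(3)[OF assms] by simp
qed

lemma scalar_subring_sum:
  assumes "scalar_subring S" "\<And>k. k \<in> B \<Longrightarrow> f k \<in> S"
  shows "sum f B \<in> S"
proof -
  have "0 \<in> S" using scalar_subringD(1)[OF assms(1), of 0] by simp
  then show ?thesis using assms(2)
    by (induction B rule: infinite_finite_induct) (auto intro: scalar_subringD[OF assms(1)])
qed

lemma scalar_subring_eq_UNIV:
  fixes S :: "('g, 'k::field) free_algebra set"
  assumes S: "scalar_subring S" and gens: "\<And>g. free_var g \<in> S"
  shows "S = UNIV"
proof -
  have word: "Poly_Mapping.single (Word l) 1 \<in> S" for l
  proof (induction l)
    case Nil
    then show ?case
      using scalar_subringD(1)[OF S, of 1] by (simp add: free_scalar_def zero_free_word_def)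
  next
    case (Cons g l)
    have "Poly_Mapping.single (Word (g # l)) 1
        = (free_var g * Poly_Mapping.single (Word l) 1 :: ('g, 'k) free_algebra)"
      by (simp add: free_var_def mult_single plus_free_word_def)
    then show ?case by (simp only: Cons gens scalar_subringD(3)[OF S])
  qed
  have "p \<in> S" for p
  proof (induction p rule: free_algebra_induct)
    case (single w c)
    have "Poly_Mapping.single w c = free_scalar c * Poly_Mapping.single (Word (letters w)) 1"
      by (simp add: free_scalar_def mult_single)
    then show ?case by (simp only: word scalar_subringD[OF S])
  qed (auto intro: scalar_subringD[OF S])
  then show ?thesis by auto
qed


section \<open>Representations of the free algebra on function spaces\<close>

definition linear_op :: "(('i \<Rightarrow> 'k::field) \<Rightarrow> 'i \<Rightarrow> 'k) \<Rightarrow> bool"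
  where "linear_op T \<longleftrightarrow> (\<forall>f g. T (\<lambda>k. f k + g k) = (\<lambda>k. T f k + T g k)) \<and>
    (\<forall>c f. T (\<lambda>k. c * f k) = (\<lambda>k. c * T f k))"

lemma linear_op_add: "linear_op T \<Longrightarrow> T (\<lambda>k. f k + g k) = (\<lambda>k. T f k + T g k)"
  and linear_op_scale: "linear_op T \<Longrightarrow> T (\<lambda>k. c * f k) = (\<lambda>k. c * T f k)"
  by (auto simp: linear_op_def)

text \<open>With \<open>foldr\<close> the last letter acts first, so concatenation of words becomes
  composition of operators.\<close>

definition word_act :: "('g \<Rightarrow> ('i \<Rightarrow> 'k) \<Rightarrow> 'i \<Rightarrow> 'k) \<Rightarrow> 'g free_word \<Rightarrow> ('i \<Rightarrow> 'k) \<Rightarrow> 'i \<Rightarrow> 'k"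
  where "word_act u w = foldr u (letters w)"

definition rep ::
    "('g \<Rightarrow> ('i \<Rightarrow> 'k) \<Rightarrow> 'i \<Rightarrow> 'k) \<Rightarrow> ('g, 'k::field) free_algebra \<Rightarrow> ('i \<Rightarrow> 'k) \<Rightarrow> 'i \<Rightarrow> 'k"
  where "rep u p f k =
    (\<Sum>w\<in>Poly_Mapping.keys p. Poly_Mapping.lookup p w * word_act u w f k)"

lemma rep_add: "rep u (p + r) f = (\<lambda>k. rep u p f k + rep u r f k)"
  unfolding rep_def by (intro ext setsum_keys_plus_distrib) (auto simp: algebra_simps)

lemma rep_single: "rep u (Poly_Mapping.single w c) f = (\<lambda>k. c * word_act u w f k)"
  by (auto simp: rep_def)

lemma rep_scalar: "rep u (free_scalar c) f = (\<lambda>k. c * f k)"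
  by (simp add: free_scalar_def rep_single word_act_def zero_free_word_def)

lemma rep_0: "rep u 0 f = (\<lambda>k. 0)"
  by (auto simp: rep_def)

lemma rep_1: "rep u 1 f = f"
  using rep_scalar[of u 1 f] by simp

lemma rep_var: "rep u (free_var g) = u g"
  by (auto simp: free_var_def rep_single word_act_def)

lemma linear_op_word_act:
  assumes "\<And>g. linear_op (u g)"
  shows "linear_op (word_act u w)"
proof -
  have "linear_op (foldr u l)" for l
    by (induction l) (use assms in \<open>auto simp: linear_op_def\<close>)
  then show ?thesis by (simp add: word_act_def)
qed

lemma linear_op_rep:
  assumes "\<And>g. linear_op (u g)"
  shows "linear_op (rep u p)"
proof (induction p rule: free_algebra_induct)
  case (single w c)
  show ?case using linear_op_word_act[where w = w, OF assms]
    by (auto simp: linear_op_def rep_single algebra_simps)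
next
  case (add p r)
  then show ?case by (auto simp: linear_op_def rep_add algebra_simps)
qed

text \<open>Both sides are additive in \<open>p\<close> and in \<open>r\<close>. On single words the
  identity is \<open>foldr\<close> over an append, with the inner coefficient pulled out by
  linearity.\<close>

lemma rep_mult:
  assumes u: "\<And>g. linear_op (u g)"
  shows "rep u (p * r) f = rep u p (rep u r f)"
proof (induction p rule: free_algebra_induct)
  case (single w c)
  show ?case
  proof (induction r rule: free_algebra_induct)
    case (single v d)
    show ?case
      using linear_op_scale[OF linear_op_word_act[where w = w, OF u], where c = d and f = "word_act u v f"]
      by (simp add: mult_single rep_single plus_free_word_def word_act_def mult.assoc)
  next
    case (add r s)
    then show ?case
      by (simp add: distrib_left rep_add linear_op_add[OF linear_op_rep[OF u]])
  qed
next
  case (add p q)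
  then show ?case by (simp add: distrib_right rep_add)
qed

lemma rep_uminus: "rep u (- p) f = (\<lambda>k. - rep u p f k)"
proof -
  have "(\<lambda>k. rep u p f k + rep u (- p) f k) = (\<lambda>k. 0)"
    using rep_add[of u p "- p" f] by (simp add: rep_0)
  then show ?thesis by (auto simp: fun_eq_iff add_eq_0_iff)
qed

lemma rep_diff: "rep u (p - r) f = (\<lambda>k. rep u p f k - rep u r f k)"
  using rep_add[of u p "- r" f] by (simp add: rep_uminus)

lemma rep_sum: "rep u (sum p B) f = (\<lambda>k. \<Sum>b\<in>B. rep u (p b) f k)"
  by (induction B rule: infinite_finite_induct) (simp_all add: rep_0 rep_add)


section \<open>The quotient algebra\<close>

lemma free_ring_simps [simp]:
  "carrier free_ring = UNIV" "a \<otimes>\<^bsub>free_ring\<^esub> b = a * b" "a \<oplus>\<^bsub>free_ring\<^esub> b = a + b"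
  "\<zero>\<^bsub>free_ring\<^esub> = 0" "\<one>\<^bsub>free_ring\<^esub> = 1"
  by (simp_all add: free_ring_def ring_of_type_algebra_def)

lemma free_ring_uminus [simp]: "\<ominus>\<^bsub>free_ring\<^esub> a = - a"
  using abelian_group.minus_equality[OF ring.is_abelian_group[OF free_ring_ring], of "- a" a]
  by simp

locale quad =
  fixes q1 q2 q3 q4 :: "'k::field"
begin

abbreviation (input) "I \<equiv> quad_ideal q1 q2 q3 q4"
abbreviation (input) "cls \<equiv> quad_class q1 q2 q3 q4"
abbreviation (input) "A \<equiv> quad_algebra q1 q2 q3 q4"
abbreviation (input) "K \<equiv> range (quad_scalar q1 q2 q3 q4)"

interpretation I: ideal I free_ring by (rule quad_ideal_ideal)

lemma quad_ideal_0: "0 \<in> I" and quad_ideal_add: "p \<in> I \<Longrightarrow> r \<in> I \<Longrightarrow> p + r \<in> I"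
  and quad_ideal_uminus: "p \<in> I \<Longrightarrow> - p \<in> I"
  and quad_ideal_mult_left: "p \<in> I \<Longrightarrow> r * p \<in> I"
  and quad_ideal_mult_right: "p \<in> I \<Longrightarrow> p * r \<in> I"
  using additive_subgroup.zero_closed[OF I.additive_subgroup_axioms]
    additive_subgroup.a_closed[OF I.additive_subgroup_axioms, of p r]
    additive_subgroup.a_inv_closed[OF I.additive_subgroup_axioms, of p]
    I.I_l_closed[of p r] I.I_r_closed[of p r]
  by simp_all

lemma quad_relator_mem: "quad_relator q1 q2 q3 q4 \<in> I"
  unfolding quad_ideal_def by (rule ring.genideal_self'[OF free_ring_ring]) simp

lemma quad_class_eq_iff: "cls p = cls r \<longleftrightarrow> p - r \<in> I"
proof
  assume "cls p = cls r"
  then have "p \<in> I +>\<^bsub>free_ring\<^esub> r"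
    using I.a_rcos_self[of p] by (simp add: quad_class_def)
  then show "p - r \<in> I" using I.a_rcos_module[of r p] by simp
next
  assume "p - r \<in> I"
  then have "p \<in> I +>\<^bsub>free_ring\<^esub> r" using I.a_rcos_module[of r p] by simp
  then show "cls p = cls r"
    unfolding quad_class_def by (metis I.a_repr_independence' free_ring_simps(1) UNIV_I)
qed

lemma carrier_quad_algebra: "carrier A = range cls"
  by (auto simp: quad_algebra_def FactRing_def A_RCOSETS_def' quad_class_def)

lemma quad_class_mult: "cls (p * r) = cls p \<otimes>\<^bsub>A\<^esub> cls r"
  and quad_class_add: "cls (p + r) = cls p \<oplus>\<^bsub>A\<^esub> cls r"
  and quad_class_1: "cls 1 = \<one>\<^bsub>A\<^esub>"
  using ring_hom_mult[OF quad_class_hom, of p r] ring_hom_add[OF quad_class_hom, of p r]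
    ring_hom_one[OF quad_class_hom, of q1 q2 q3 q4] by simp_all

interpretation A: ring A by (rule quad_algebra_ring)

lemma quad_class_closed: "cls p \<in> carrier A"
  by (simp add: carrier_quad_algebra)

lemma quad_class_0: "cls 0 = \<zero>\<^bsub>A\<^esub>"
  using quad_class_add[of 0 0] A.add.l_cancel_one'[of "cls 0" "cls 0"] by (simp add: quad_class_closed)

lemma quad_class_power: "cls (p ^ n) = cls p [^]\<^bsub>A\<^esub> n"
  by (induction n) (simp_all add: quad_class_1 power_Suc2 quad_class_mult del: power_Suc)

lemma quad_class_sum: "finite B \<Longrightarrow> cls (sum p B) = (\<Oplus>\<^bsub>A\<^esub>b\<in>B. cls (p b))"
  by (induction B rule: finite_induct)
    (simp_all add: quad_class_0 quad_class_add quad_class_closed)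

text \<open>Modulo \<open>I\<close>, commutation with \<open>p\<close> passes to products by the
  Leibniz rule \<open>[p, r s] = [p, r] s + r [p, s]\<close>. Hence centrality can be tested on
  generators.\<close>

lemma scalar_subring_commutant: "scalar_subring {r. p * r - r * p \<in> I}"
proof (rule scalar_subringI)
  fix r s assume rs: "r \<in> {r. p * r - r * p \<in> I}" "s \<in> {r. p * r - r * p \<in> I}"
  have "p * (r + s) - (r + s) * p = (p * r - r * p) + (p * s - s * p)"
    by (simp add: algebra_simps)
  then show "r + s \<in> {r. p * r - r * p \<in> I}" using rs quad_ideal_add by auto
  have "p * (r * s) - (r * s) * p = (p * r - r * p) * s + r * (p * s - s * p)"
    by (simp add: algebra_simps)
  then show "r * s \<in> {r. p * r - r * p \<in> I}"
    using rs quad_ideal_add quad_ideal_mult_left quad_ideal_mult_right by auto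
qed (simp add: free_scalar_commute quad_ideal_0)

lemma quad_class_center_iff:
  "cls p \<in> ring_center A \<longleftrightarrow> (\<forall>r. p * r - r * p \<in> I)"
  by (auto simp: ring_center_def quad_class_closed carrier_quad_algebra quad_class_eq_iff
      simp flip: quad_class_mult)

lemma ring_center_subring: "subring (ring_center A) A"
proof (rule A.subringI)
  have closed: "h \<in> carrier A" and comm: "a \<in> carrier A \<Longrightarrow> h \<otimes>\<^bsub>A\<^esub> a = a \<otimes>\<^bsub>A\<^esub> h"
    if "h \<in> ring_center A" for h a
    using that by (auto simp: ring_center_def)
  have centerI: "h \<in> ring_center A"
    if "h \<in> carrier A" "\<And>a. a \<in> carrier A \<Longrightarrow> h \<otimes>\<^bsub>A\<^esub> a = a \<otimes>\<^bsub>A\<^esub> h" for h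
    using that by (auto simp: ring_center_def)
  show "ring_center A \<subseteq> carrier A" by (auto simp: closed)
  show "\<one>\<^bsub>A\<^esub> \<in> ring_center A" by (rule centerI) auto
  fix h1 assume 1: "h1 \<in> ring_center A"
  show "\<ominus>\<^bsub>A\<^esub> h1 \<in> ring_center A"
    by (rule centerI) (simp_all add: closed[OF 1] A.l_minus A.r_minus comm[OF 1])
  fix h2 assume 2: "h2 \<in> ring_center A"
  show "h1 \<oplus>\<^bsub>A\<^esub> h2 \<in> ring_center A"
    by (rule centerI) (simp_all add: closed 1 2 A.l_distr A.r_distr comm[OF 1] comm[OF 2])
  show "h1 \<otimes>\<^bsub>A\<^esub> h2 \<in> ring_center A"
  proof (rule centerI)
    fix a assume a: "a \<in> carrier A"
    have "h1 \<otimes>\<^bsub>A\<^esub> h2 \<otimes>\<^bsub>A\<^esub> a = h1 \<otimes>\<^bsub>A\<^esub> (a \<otimes>\<^bsub>A\<^esub> h2)"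
      using a by (simp add: A.m_assoc closed 1 2 comm[OF 2])
    also have "\<dots> = h1 \<otimes>\<^bsub>A\<^esub> a \<otimes>\<^bsub>A\<^esub> h2"
      using a by (simp add: A.m_assoc closed 1 2)
    also have "\<dots> = a \<otimes>\<^bsub>A\<^esub> (h1 \<otimes>\<^bsub>A\<^esub> h2)"
      using a by (simp add: A.m_assoc closed 1 2 comm[OF 1])
    finally show "h1 \<otimes>\<^bsub>A\<^esub> h2 \<otimes>\<^bsub>A\<^esub> a = a \<otimes>\<^bsub>A\<^esub> (h1 \<otimes>\<^bsub>A\<^esub> h2)" .
  qed (simp add: closed 1 2)
qed

lemma scalar_mem_ring_center: "cls (free_scalar c) \<in> ring_center A"
  by (simp add: quad_class_center_iff free_scalar_commute quad_ideal_0)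

lemma subalgebraI:
  assumes "subring V A" "K \<subseteq> V"
  shows "subalgebra K V A"
proof -
  interpret V: subring V A by fact
  show ?thesis
    using assms(2) by unfold_locales auto
qed

lemma generated_subalgebra_subset_ring_center:
  assumes "S \<subseteq> ring_center A"
  shows "generated_subalgebra K A S \<subseteq> ring_center A"
proof -
  have "subalgebra K (ring_center A) A"
    using scalar_mem_ring_center by (intro subalgebraI ring_center_subring) (auto simp: quad_scalar_def)
  then show ?thesis
    using ring_center_subring assms by (auto simp: generated_subalgebra_def)
qed

text \<open>The preimage under \<open>cls\<close> of a subalgebra of the quotient is a
  \<open>scalar_subring\<close>, so membership can be checked in the free algebra.\<close>

lemma quad_class_mem_generated_subalgebra:
  assumes "\<And>S. scalar_subring S \<Longrightarrow> B \<subseteq> S \<Longrightarrow> p \<in> S"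
  shows "cls p \<in> generated_subalgebra K A (cls ` B)"
  unfolding generated_subalgebra_def
proof (intro InterI, clarify)
  fix V assume V: "subring V A" "subalgebra K V A" "cls ` B \<subseteq> V"
  interpret V: subring V A by fact
  have K: "cls (free_scalar c) \<in> V" for c
  proof -
    have "quad_scalar q1 q2 q3 q4 c \<otimes>\<^bsub>A\<^esub> \<one>\<^bsub>A\<^esub> \<in> V"
      by (rule subalgebra.smult_closed[OF V(2)]) auto
    then show ?thesis by (simp add: quad_scalar_def quad_class_closed)
  qed
  have "scalar_subring (cls -` V)"
    using K V.m_closed subgroup.m_closed[OF V.subgroup_axioms]
    by (intro scalar_subringI) (auto simp: quad_class_add quad_class_mult)
  then show "cls p \<in> V" using assms V(3) by auto
qed

end


section \<open>Coordinates with respect to the monomials\<close>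

text \<open>The q-integer \<open>[n]\<close>; it is the coefficient that accumulates when
  \<open>Y\<close> is moved past \<open>X^n\<close>.\<close>

definition qint :: "'k::field \<Rightarrow> nat \<Rightarrow> 'k"
  where "qint q n = (\<Sum>i<n. q ^ i)"

lemma qint_0 [simp]: "qint q 0 = 0"
  and qint_Suc: "qint q (Suc n) = qint q n + q ^ n"
  by (simp_all add: qint_def)

lemma qint_Suc': "qint q (Suc n) = 1 + q * qint q n"
  by (simp add: qint_def sum.lessThan_Suc_shift sum_distrib_left del: sum.lessThan_Suc)

lemma qint_1_left: "qint 1 n = of_nat n"
  by (simp add: qint_def)

lemma one_minus_mult_qint: "(1 - q) * qint q n = 1 - q ^ n"
  by (simp add: qint_def one_diff_power_eq)

definition unit_vec :: "'i \<Rightarrow> 'i \<Rightarrow> 'k::field"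
  where "unit_vec k l = (if l = k then 1 else 0)"

definition left_x :: "(nat \<times> nat \<Rightarrow> 'k::field) \<Rightarrow> nat \<times> nat \<Rightarrow> 'k"
  where "left_x f = (\<lambda>(i, j). if i = 0 then 0 else f (i - 1, j))"

text \<open>Induction on \<open>i\<close> gives
  \<open>Y X^i = q^i X^i Y + a [i] X^i + c [i] X^(i - 1)\<close>. The value at \<open>(i, j)\<close>
  collects the contributions to \<open>X^i Y^j\<close>, so the last term comes from index
  \<open>Suc i\<close>.\<close>

definition left_y :: "'k \<Rightarrow> 'k \<Rightarrow> 'k \<Rightarrow> (nat \<times> nat \<Rightarrow> 'k::field) \<Rightarrow> nat \<times> nat \<Rightarrow> 'k"
  where "left_y q a c f = (\<lambda>(i, j). (if j = 0 then 0 else q ^ i * f (i, j - 1))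
    + a * qint q i * f (i, j) + c * qint q (Suc i) * f (Suc i, j))"

definition right_y :: "(nat \<times> nat \<Rightarrow> 'k::field) \<Rightarrow> nat \<times> nat \<Rightarrow> 'k"
  where "right_y f = (\<lambda>(i, j). if j = 0 then 0 else f (i, j - 1))"

text \<open>
  Here \<open>a = 0\<close>, since otherwise right multiplication by \<open>X\<close> does not extend to arrays of infinite
  support.
\<close>

definition right_x :: "'k \<Rightarrow> 'k \<Rightarrow> (nat \<times> nat \<Rightarrow> 'k::field) \<Rightarrow> nat \<times> nat \<Rightarrow> 'k"
  where "right_x q c f = (\<lambda>(i, j). (if i = 0 then 0 else q ^ j * f (i - 1, j))
    + c * qint q (Suc j) * f (i, Suc j))"

lemma linear_op_right_x: "linear_op (right_x q c)"
  and linear_op_right_y: "linear_op right_y"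
  by (auto simp: linear_op_def right_x_def right_y_def fun_eq_iff algebra_simps)

text \<open>The operators satisfy the relation \<open>YX = q XY + a X + c\<close>, which makes the
  arrays a module over the algebra. The essential identity is
  \<open>[i + 1] = 1 + q [i]\<close>.\<close>

lemma left_y_left_x:
  "left_y q a c (left_x f) = (\<lambda>k. q * left_x (left_y q a c f) k + a * left_x f k + c * f k)"
proof (rule ext, clarify)
  fix i j
  show "left_y q a c (left_x f) (i, j)
      = q * left_x (left_y q a c f) (i, j) + a * left_x f (i, j) + c * f (i, j)"
    by (cases i) (auto simp: left_x_def left_y_def qint_Suc' algebra_simps)
qed

lemma left_x_right_y: "left_x (right_y f) = right_y (left_x f)"
  and left_y_right_y: "left_y q a c (right_y f) = right_y (left_y q a c f)"
  and left_x_right_x: "left_x (right_x q c f) = right_x q c (left_x f)"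
  by (auto simp: left_x_def left_y_def right_y_def right_x_def fun_eq_iff)

text \<open>This is the associativity \<open>Y (f X) = (Y f) X\<close>, verified on arrays without
  reference to a product.\<close>

lemma left_y_right_x: "left_y q 0 c (right_x q c f) = right_x q c (left_y q 0 c f)"
proof (rule ext, clarify)
  fix i j
  show "left_y q 0 c (right_x q c f) (i, j) = right_x q c (left_y q 0 c f) (i, j)"
    by (cases i; cases j)
      (auto simp: left_y_def right_x_def qint_Suc algebra_simps)
qed

lemma left_x_unit: "left_x (unit_vec (i, j)) = unit_vec (Suc i, j)"
  and right_y_unit: "right_y (unit_vec (i, j)) = unit_vec (i, Suc j)"
  and left_y_unit: "left_y q a c (unit_vec (0, j)) = unit_vec (0, Suc j)"
  by (auto simp: left_x_def left_y_def right_y_def unit_vec_def fun_eq_iff)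

lemma right_x_unit: "right_x q c (unit_vec (i, 0)) = unit_vec (Suc i, 0)"
  by (auto simp: right_x_def unit_vec_def fun_eq_iff)

text \<open>The elements \<open>x\<close>, \<open>y\<close> are lifts of the new generators
  \<open>X\<close>, \<open>Y\<close>. The action \<open>u\<close> is prescribed on the original
  generators, so that the new ones act by \<open>left_x\<close> and \<open>left_y\<close>. The new
  relator is \<open>d\<close> times the old one with \<open>d\<close> nonzero, so both generate the
  same ideal.\<close>

locale quad_coords =
  quad q1 q2 q3 q4 for q1 q2 q3 q4 :: "'k::field" +
  fixes q a c d :: 'k
    and x y :: "(gen_xy, 'k) free_algebra"
    and u :: "gen_xy \<Rightarrow> (nat \<times> nat \<Rightarrow> 'k) \<Rightarrow> nat \<times> nat \<Rightarrow> 'k"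
  assumes linear_u: "linear_op (u g)"
    and rep_x: "rep u x = left_x"
    and rep_y: "rep u y = left_y q a c"
    and gens: "scalar_subring S \<Longrightarrow> x \<in> S \<Longrightarrow> y \<in> S \<Longrightarrow> free_var g \<in> S"
    and relator: "y * x - (free_scalar q * (x * y) + free_scalar a * x + free_scalar c)
      = free_scalar d * quad_relator q1 q2 q3 q4"
    and d_nonzero: "d \<noteq> 0"
begin


section \<open>The array module and the monomial basis\<close>

lemmas rep_prod = rep_mult[where u = u, OF linear_u]

lemma scalar_subring_UNIV: "scalar_subring S \<Longrightarrow> x \<in> S \<Longrightarrow> y \<in> S \<Longrightarrow> p \<in> S"
  using scalar_subring_eq_UNIV[OF _ gens] by blast

lemma rep_relator: "rep u (quad_relator q1 q2 q3 q4) f = (\<lambda>k. 0)"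
proof -
  have "rep u (free_scalar d * quad_relator q1 q2 q3 q4) f = (\<lambda>k. 0)"
    unfolding relator[symmetric]
    by (simp add: rep_diff rep_add rep_prod rep_scalar rep_x rep_y left_y_left_x)
  then show ?thesis
    using d_nonzero by (simp add: rep_prod rep_scalar fun_eq_iff)
qed

text \<open>The annihilator of a module is a two-sided ideal, and here it contains the relator. The
  action thus descends to the quotient.\<close>

lemma rep_quad_ideal:
  assumes "p \<in> I"
  shows "rep u p f = (\<lambda>k. 0)"
proof -
  let ?N = "{p. \<forall>f. rep u p f = (\<lambda>k. 0)}"
  interpret ring "free_ring :: (gen_xy, 'k) free_algebra ring" by (rule free_ring_ring)
  have zero: "rep u p (\<lambda>k. 0) = (\<lambda>k. 0)" for p
    using linear_op_scale[OF linear_op_rep[where u = u, OF linear_u], where c = 0] by simp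
  have "ideal ?N free_ring"
  proof (rule idealI)
    show "subgroup ?N (add_monoid free_ring)"
      using free_ring_uminus[where ?'b = 'k and ?'a = gen_xy]
      by (intro add.subgroupI) (auto simp: rep_add rep_uminus rep_0 intro!: exI[of _ 0] simp flip: a_inv_def)
  qed (simp_all add: free_ring_ring rep_prod zero)
  then have "I \<subseteq> ?N"
    unfolding quad_ideal_def by (rule genideal_minimal) (simp add: rep_relator)
  then show ?thesis using assms by auto
qed

text \<open>The array \<open>unit_vec (0, 0)\<close> represents the monomial \<open>1\<close>, so
  acting on it by \<open>p\<close> yields the coefficients of \<open>p\<close>.\<close>

definition coord :: "(gen_xy, 'k) free_algebra \<Rightarrow> nat \<times> nat \<Rightarrow> 'k"
  where "coord p = rep u p (unit_vec (0, 0))"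

definition pbw_mono :: "nat \<times> nat \<Rightarrow> (gen_xy, 'k) free_algebra"
  where "pbw_mono k = x ^ fst k * y ^ snd k"

lemma rep_y_power: "rep u (y ^ j) (unit_vec (0, 0)) = unit_vec (0, j)"
  by (induction j) (simp_all add: rep_1 rep_prod rep_y left_y_unit)

lemma rep_x_power: "rep u (x ^ i) (unit_vec (0, j)) = unit_vec (i, j)"
  by (induction i) (simp_all add: rep_1 rep_prod rep_x left_x_unit)

lemma coord_pbw_mono: "coord (pbw_mono k) = unit_vec k"
  by (cases k) (simp add: coord_def pbw_mono_def rep_prod rep_y_power rep_x_power)

lemma coord_cong: "p - r \<in> I \<Longrightarrow> coord p = coord r"
  using rep_quad_ideal[of "p - r" "unit_vec (0, 0)"] by (simp add: coord_def rep_diff fun_eq_iff)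

text \<open>This is \<open>I\<close> plus the span of the monomials \<open>X^i Y^j\<close>.
  Stability under left multiplication by \<open>x\<close> and \<open>y\<close> shows that it is
  everything.\<close>

inductive_set normal_forms :: "(gen_xy, 'k) free_algebra set" where
  ideal: "p \<in> I \<Longrightarrow> p \<in> normal_forms"
| mono: "free_scalar b * pbw_mono k \<in> normal_forms"
| add: "p \<in> normal_forms \<Longrightarrow> r \<in> normal_forms \<Longrightarrow> p + r \<in> normal_forms"

lemma normal_forms_scalar: "p \<in> normal_forms \<Longrightarrow> free_scalar b * p \<in> normal_forms"
proof (induction rule: normal_forms.induct)
  case (mono e k)
  show ?case
    using normal_forms.mono[of "b * e" k] by (simp add: free_scalar_mult mult.assoc)
qed (auto simp: distrib_left intro: normal_forms.intros quad_ideal_mult_left)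

lemma normal_forms_x: "p \<in> normal_forms \<Longrightarrow> x * p \<in> normal_forms"
proof (induction rule: normal_forms.induct)
  case (mono e k)
  show ?case
    using normal_forms.mono[of e "(Suc (fst k), snd k)"]
    by (simp add: pbw_mono_def free_scalar_left_commute mult.assoc)
qed (auto simp: distrib_left intro: normal_forms.intros quad_ideal_mult_left)

lemma normal_forms_y_pbw_mono: "y * pbw_mono (i, j) \<in> normal_forms"
proof (induction i)
  case 0
  show ?case using normal_forms.mono[of 1 "(0, Suc j)"] by (simp add: pbw_mono_def)
next
  case (Suc i)
  \<comment> \<open>The relator moves \<open>y\<close> past a single \<open>x\<close>; the remaining
    product \<open>y * pbw_mono (i, j)\<close> is covered by the induction hypothesis.\<close>
  have "y * pbw_mono (Suc i, j) = free_scalar d * quad_relator q1 q2 q3 q4 * pbw_mono (i, j)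
      + (free_scalar q * (x * (y * pbw_mono (i, j))) + free_scalar a * pbw_mono (Suc i, j)
          + free_scalar c * pbw_mono (i, j))"
    unfolding relator[symmetric] by (simp add: pbw_mono_def algebra_simps)
  moreover have "free_scalar d * quad_relator q1 q2 q3 q4 * pbw_mono (i, j) \<in> I"
    by (intro quad_ideal_mult_left quad_ideal_mult_right quad_relator_mem)
  ultimately show ?case
    by (simp only:) (intro normal_forms.intros normal_forms_scalar normal_forms_x Suc)
qed

lemma normal_forms_y: "p \<in> normal_forms \<Longrightarrow> y * p \<in> normal_forms"
proof (induction rule: normal_forms.induct)
  case (mono e k)
  show ?case
    using normal_forms_scalar[OF normal_forms_y_pbw_mono[of "fst k" "snd k"], of e]
    by (simp add: free_scalar_left_commute)
qed (auto simp: distrib_left intro: normal_forms.intros quad_ideal_mult_left)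

lemma normal_forms_UNIV: "p \<in> normal_forms"
proof -
  \<comment> \<open>The multipliers that preserve normal forms are a subalgebra containing the
    generators; applying them to \<open>1\<close> gives the claim.\<close>
  let ?S = "{r. \<forall>p\<in>normal_forms. r * p \<in> normal_forms}"
  have "p \<in> ?S"
    by (rule scalar_subring_UNIV, rule scalar_subringI)
      (auto simp: normal_forms_scalar normal_forms_x normal_forms_y distrib_right mult.assoc
        intro: normal_forms.add)
  moreover have "1 \<in> normal_forms"
    using normal_forms.mono[of 1 "(0, 0)"] by (simp add: pbw_mono_def)
  ultimately have "p * 1 \<in> normal_forms" by blast
  then show ?thesis by simp
qed

lemma PBW:
  "finite {k. coord p k \<noteq> 0} \<and>
   p - (\<Sum>k | coord p k \<noteq> 0. free_scalar (coord p k) * pbw_mono k) \<in> I"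
proof -
  \<comment> \<open>The induction uses a finite superset \<open>B\<close> of the support, because
    coefficients may cancel in a sum.\<close>
  have "\<exists>B. finite B \<and> {k. coord p k \<noteq> 0} \<subseteq> B \<and>
      p - (\<Sum>k\<in>B. free_scalar (coord p k) * pbw_mono k) \<in> I"
    using normal_forms_UNIV[of p]
  proof (induction rule: normal_forms.induct)
    case (ideal p)
    then have "coord p = (\<lambda>k. 0)" by (simp add: coord_def rep_quad_ideal)
    then show ?case using ideal by (intro exI[of _ "{}"]) simp
  next
    case (mono b k)
    have "coord (free_scalar b * pbw_mono k) = (\<lambda>l. b * unit_vec k l)"
      using coord_pbw_mono[of k] by (simp add: coord_def rep_prod rep_scalar)
    then show ?case
      by (intro exI[of _ "{k}"]) (auto simp: unit_vec_def quad_ideal_0)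
  next
    case (add p r)
    then obtain B C where B: "finite B" "{k. coord p k \<noteq> 0} \<subseteq> B"
        "p - (\<Sum>k\<in>B. free_scalar (coord p k) * pbw_mono k) \<in> I"
      and C: "finite C" "{k. coord r k \<noteq> 0} \<subseteq> C"
        "r - (\<Sum>k\<in>C. free_scalar (coord r k) * pbw_mono k) \<in> I" by blast
    have *: "coord (p + r) = (\<lambda>k. coord p k + coord r k)"
      by (simp add: coord_def rep_add)
    have "coord p k = 0" if "k \<notin> B" for k using B(2) that by auto
    moreover have "coord r k = 0" if "k \<notin> C" for k using C(2) that by auto
    ultimately have "(\<Sum>k\<in>B \<union> C. free_scalar (coord p k) * pbw_mono k) 
        = (\<Sum>k\<in>B. free_scalar (coord p k) * pbw_mono k)"
      "(\<Sum>k\<in>B \<union> C. free_scalar (coord r k) * pbw_mono k)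
        = (\<Sum>k\<in>C. free_scalar (coord r k) * pbw_mono k)"
      using B(1) C(1) by (auto intro!: sum.mono_neutral_right simp del: split_paired_All)
    then have "p + r - (\<Sum>k\<in>B \<union> C. free_scalar (coord (p + r) k) * pbw_mono k)
        = (p - (\<Sum>k\<in>B. free_scalar (coord p k) * pbw_mono k))
          + (r - (\<Sum>k\<in>C. free_scalar (coord r k) * pbw_mono k))"
      by (simp add: * free_scalar_add distrib_right sum.distrib)
    then have "p + r - (\<Sum>k\<in>B \<union> C. free_scalar (coord (p + r) k) * pbw_mono k) \<in> I"
      using quad_ideal_add[OF B(3) C(3)] by (simp only:)
    moreover have "{k. coord (p + r) k \<noteq> 0} \<subseteq> B \<union> C" using B(2) C(2) by (force simp: *)
    ultimately show ?case using B(1) C(1) by (intro exI[of _ "B \<union> C"]) simp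
  qed
  then obtain B where B: "finite B" "{k. coord p k \<noteq> 0} \<subseteq> B"
      "p - (\<Sum>k\<in>B. free_scalar (coord p k) * pbw_mono k) \<in> I" by blast
  have "(\<Sum>k\<in>B. free_scalar (coord p k) * pbw_mono k)
      = (\<Sum>k | coord p k \<noteq> 0. free_scalar (coord p k) * pbw_mono k)"
    using B by (auto intro!: sum.mono_neutral_right)
  then show ?thesis using B finite_subset[OF B(2,1)] by simp
qed

lemmas finite_coord = PBW[THEN conjunct1] and coord_expansion = PBW[THEN conjunct2]

lemma quad_class_eq_iff_coord: "cls p = cls r \<longleftrightarrow> coord p = coord r"
proof
  assume "coord p = coord r"
  then have "cls p = cls (\<Sum>k | coord r k \<noteq> 0. free_scalar (coord r k) * pbw_mono k)"
    using coord_expansion[of p] by (simp add: quad_class_eq_iff)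
  also have "\<dots> = cls r" using coord_expansion[of r] by (simp add: quad_class_eq_iff[symmetric])
  finally show "cls p = cls r" .
qed (simp add: quad_class_eq_iff coord_cong)

text \<open>The elements whose action commutes with \<open>T\<close> form a subalgebra. This is
  applied with \<open>T\<close> a right multiplication.\<close>

lemma rep_commute:
  assumes T: "linear_op T" and "\<And>f. left_x (T f) = T (left_x f)"
    and "\<And>f. left_y q a c (T f) = T (left_y q a c f)"
  shows "rep u p (T f) = T (rep u p f)"
proof -
  have "p \<in> {p. \<forall>f. rep u p (T f) = T (rep u p f)}"
    by (rule scalar_subring_UNIV, rule scalar_subringI)
      (auto simp: assms rep_scalar rep_add rep_prod rep_x rep_y linear_op_add[OF T]
        linear_op_scale[OF T])
  then show ?thesis by blast
qed

lemma coord_mult_x: "coord (x * p) = left_x (coord p)"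
  and coord_mult_y: "coord (y * p) = left_y q a c (coord p)"
  by (simp_all add: coord_def rep_prod rep_x rep_y)

text \<open>On the array of \<open>1\<close>, left and right multiplication by \<open>Y\<close>
  agree. Since \<open>right_y\<close> commutes with the action of \<open>p\<close>, it can be pulled
  out.\<close>

lemma coord_mult_y_right: "coord (p * y) = right_y (coord p)"
  using rep_commute[OF linear_op_right_y left_x_right_y left_y_right_y, of p "unit_vec (0, 0)"]
  by (simp add: coord_def rep_prod rep_y left_y_unit right_y_unit)

lemma coord_mult_x_right:
  assumes "a = 0"
  shows "coord (p * x) = right_x q c (coord p)"
  using rep_commute[OF linear_op_right_x left_x_right_x, of q c p "unit_vec (0, 0)"] assms
  by (simp add: coord_def rep_prod rep_x left_x_unit right_x_unit left_y_right_x)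

lemma center_iff_coord:
  "cls p \<in> ring_center A \<longleftrightarrow> coord (p * x) = coord (x * p) \<and> coord (p * y) = coord (y * p)"
proof -
  have "cls p \<in> ring_center A \<longleftrightarrow> p * x - x * p \<in> I \<and> p * y - y * p \<in> I"
    unfolding quad_class_center_iff
    using scalar_subring_UNIV[OF scalar_subring_commutant[of p]] by blast
  then show ?thesis by (simp add: quad_class_eq_iff_coord flip: quad_class_eq_iff)
qed

lemma center_eq_scalarsI:
  assumes "\<And>p k. cls p \<in> ring_center A \<Longrightarrow> coord p k \<noteq> 0 \<Longrightarrow> k = (0, 0)"
  shows "ring_center A = K"
proof
  show "ring_center A \<subseteq> K"
  proof
    fix z assume z: "z \<in> ring_center A"
    then obtain p where p: "z = cls p"
      by (auto simp: ring_center_def carrier_quad_algebra)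
    have "coord (free_scalar (coord p (0, 0))) = coord p"
      using assms[of p] z p
      by (force simp: fun_eq_iff coord_def rep_scalar unit_vec_def)
    then have "z = quad_scalar q1 q2 q3 q4 (coord p (0, 0))"
      using p by (simp add: quad_scalar_def quad_class_eq_iff_coord)
    then show "z \<in> K" by blast
  qed
qed (auto simp: quad_scalar_def scalar_mem_ring_center)

end


section \<open>The centre\<close>

text \<open>Stated for an arbitrary array of finite support, so that it applies to a coefficient
  array and also to its transpose.\<close>

lemma diagonal_descent:
  fixes m :: "nat \<times> nat \<Rightarrow> 'k::field"
  assumes "finite {k. m k \<noteq> 0}" "q \<noteq> 1"
    and step: "\<And>i j. (1 - q ^ j) * m (i, j) = c * qint q (Suc j) * m (Suc i, Suc j)"
    and "q ^ j \<noteq> 1"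
  shows "m (i, j) = 0"
proof -
  have "finite (fst ` {k. m k \<noteq> 0})" using assms(1) by simp
  then obtain N where N: "\<And>i. i \<in> fst ` {k. m k \<noteq> 0} \<Longrightarrow> i < N"
    unfolding finite_nat_set_iff_bounded by blast
  have zero: "m (i, j) = 0" if "N \<le> i" for i j
    using N[of i] that by force
  show ?thesis
    using assms(4)
  \<comment> \<open>The induction runs on the distance to the edge of the support, beyond which all
    entries vanish.\<close>
  proof (induction "N - i" arbitrary: i j)
    case 0
    then show ?case using zero by simp
  next
    case (Suc l)
    have "qint q (Suc j) * m (Suc i, Suc j) = 0"
    proof (cases "q ^ Suc j = 1")
      case True
      then have "(1 - q) * qint q (Suc j) = 0" unfolding one_minus_mult_qint by simp
      then show ?thesis using assms(2) by simp
    next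
      case False
      have "l = N - Suc i" using Suc.hyps(2) by simp
      then show ?thesis using Suc.hyps(1)[OF _ False] by simp
    qed
    then have "(1 - q ^ j) * m (i, j) = 0" using step[of j i] by (simp add: mult.assoc)
    then show ?case using Suc.prems by simp
  qed
qed

lemma primitive_root_of_unity_dvd:
  assumes "primitive_root_of_unity n q" "q ^ m = 1"
  shows "n dvd m"
proof -
  have n: "n \<ge> 1" "q ^ n = 1" using assms(1) by (auto simp: primitive_root_of_unity_def)
  have "q ^ m = (q ^ n) ^ (m div n) * q ^ (m mod n)"
    by (simp flip: power_mult power_add)
  then have "q ^ (m mod n) = 1" using n assms(2) by simp
  moreover have "m mod n < n" using n by simp
  ultimately have "m mod n = 0"
    using assms(1) by (metis primitive_root_of_unity_def less_one not_le)
  then show ?thesis by auto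
qed

section \<open>The centre for \<open>a = 0\<close> and \<open>q\<close> different from 1\<close>

context quad_coords
begin

lemma center_coord_right_x:
  assumes "cls p \<in> ring_center A" "a = 0"
  shows "right_x q c (coord p) = left_x (coord p)"
  using assms by (simp add: center_iff_coord coord_mult_x coord_mult_x_right)

lemma center_coord_right_y:
  assumes "cls p \<in> ring_center A"
  shows "right_y (coord p) = left_y q a c (coord p)"
  using assms by (simp add: center_iff_coord coord_mult_y coord_mult_y_right)

lemma center_coord_root:
  assumes p: "cls p \<in> ring_center A" and "a = 0" "q \<noteq> 1" "coord p (i, j) \<noteq> 0"
  shows "q ^ i = 1" "q ^ j = 1"
proof -
  let ?m = "coord p"
  \<comment> \<open>Entry \<open>(Suc i, j)\<close> of the equation between \<open>zX\<close> and
    \<open>Xz\<close>.\<close>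
  have "(1 - q ^ j) * ?m (i, j) = c * qint q (Suc j) * ?m (Suc i, Suc j)" for i j
    using fun_cong[OF center_coord_right_x[OF p \<open>a = 0\<close>], of "(Suc i, j)"]
    by (simp add: right_x_def left_x_def algebra_simps)
  then show "q ^ j = 1"
    using diagonal_descent[of ?m q c j i, OF finite_coord] assms by blast
  have "(1 - q ^ i) * ?m (i, j) = c * qint q (Suc i) * ?m (Suc i, Suc j)" for i j
    using fun_cong[OF center_coord_right_y[OF p], of "(i, Suc j)"] \<open>a = 0\<close>
    by (simp add: right_y_def left_y_def algebra_simps)
  \<comment> \<open>Transposing the array exchanges the roles of \<open>i\<close> and
    \<open>j\<close>, so the same descent applies.\<close>
  moreover have "finite {k. (?m \<circ> prod.swap) k \<noteq> 0}"
    using finite_vimageI[OF finite_coord[of p], of prod.swap] by (simp add: vimage_def)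
  ultimately show "q ^ i = 1"
    using diagonal_descent[of "?m \<circ> prod.swap" q c i j] assms by auto
qed

lemma center_not_root_of_unity:
  assumes "a = 0" "\<not> root_of_unity q"
  shows "ring_center A = K"
proof (rule center_eq_scalarsI)
  have "q \<noteq> 1" using assms(2) by (auto simp: root_of_unity_def)
  fix p k assume "cls p \<in> ring_center A" "coord p k \<noteq> 0"
  then have "q ^ fst k = 1" "q ^ snd k = 1"
    using center_coord_root[of p "fst k" "snd k"] assms(1) \<open>q \<noteq> 1\<close> by auto
  then have "\<not> 1 \<le> fst k" "\<not> 1 \<le> snd k" using assms(2) by (auto simp: root_of_unity_def)
  then show "k = (0, 0)" by (simp add: prod_eq_iff)
qed

lemma power_mem_center:
  assumes "a = 0" "q ^ n = 1" "q \<noteq> 1"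
  shows "cls (x ^ n) \<in> ring_center A" "cls (y ^ n) \<in> ring_center A"
proof -
  \<comment> \<open>The correction terms in \<open>Y X^n\<close> and \<open>Y^n X\<close> carry the
    factor \<open>c [n]\<close>, which vanishes because \<open>q^n = 1\<close>.\<close>
  have "(1 - q) * qint q n = 0" unfolding one_minus_mult_qint using assms by simp
  then have n: "qint q n = 0" using assms by simp
  have coord: "coord (x ^ n) = unit_vec (n, 0)" "coord (y ^ n) = unit_vec (0, n)"
    using coord_pbw_mono[of "(n, 0)"] coord_pbw_mono[of "(0, n)"] by (simp_all add: pbw_mono_def)
  have "left_y q a c (unit_vec (n, 0)) = right_y (unit_vec (n, 0))"
    using n assms by (auto simp: left_y_def right_y_def unit_vec_def fun_eq_iff)
  then have "coord (x ^ n * y) = coord (y * x ^ n)"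
    by (simp add: coord_mult_y coord_mult_y_right coord)
  then show "cls (x ^ n) \<in> ring_center A"
    by (simp add: center_iff_coord power_commutes)
  have "right_x q c (unit_vec (0, n)) = left_x (unit_vec (0, n))"
    using n assms by (auto simp: left_x_def right_x_def unit_vec_def fun_eq_iff)
  then have "coord (y ^ n * x) = coord (x * y ^ n)"
    by (simp add: coord_mult_x coord_mult_x_right[OF assms(1)] coord)
  then show "cls (y ^ n) \<in> ring_center A"
    by (simp add: center_iff_coord power_commutes)
qed

lemma center_primitive_root:
  assumes "a = 0" "primitive_root_of_unity n q" "n \<ge> 2"
  shows "ring_center A = generated_subalgebra K A {cls (x ^ n), cls (y ^ n)}"
proof
  have "q ^ n = 1" using assms(2) by (simp add: primitive_root_of_unity_def)
  moreover have q: "q \<noteq> 1"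
    using assms(2,3) unfolding primitive_root_of_unity_def
    by (metis One_nat_def Suc_1 le_refl less_eq_Suc_le power_one)
  ultimately show "generated_subalgebra K A {cls (x ^ n), cls (y ^ n)} \<subseteq> ring_center A"
    using power_mem_center[OF assms(1)] by (intro generated_subalgebra_subset_ring_center) auto
  show "ring_center A \<subseteq> generated_subalgebra K A {cls (x ^ n), cls (y ^ n)}"
  proof
    fix z assume z: "z \<in> ring_center A"
    then obtain p where p: "z = cls p"
      by (auto simp: ring_center_def carrier_quad_algebra)
    have "cls (\<Sum>k | coord p k \<noteq> 0. free_scalar (coord p k) * pbw_mono k)
        \<in> generated_subalgebra K A (cls ` {x ^ n, y ^ n})"
    proof (rule quad_class_mem_generated_subalgebra)
      fix S assume S: "scalar_subring S" "{x ^ n, y ^ n} \<subseteq> S"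
      \<comment> \<open>Both exponents of a monomial occurring in a central element are multiples of
        \<open>n\<close>.\<close>
      have "pbw_mono k \<in> S" if "coord p k \<noteq> 0" for k
      proof -
        have "q ^ fst k = 1" "q ^ snd k = 1"
          using center_coord_root[of p "fst k" "snd k"] that z p assms(1) q by auto
        then have "n dvd fst k" "n dvd snd k"
          using primitive_root_of_unity_dvd[OF assms(2)] by auto
        then obtain i j where "fst k = n * i" "snd k = n * j" by (auto simp: dvd_def)
        then have "pbw_mono k = (x ^ n) ^ i * (y ^ n) ^ j"
          by (simp add: pbw_mono_def power_mult)
        then show ?thesis
          using S by (auto intro: scalar_subringD(3) scalar_subring_power)
      qed
      then show "(\<Sum>k | coord p k \<noteq> 0. free_scalar (coord p k) * pbw_mono k) \<in> S"
        by (intro scalar_subring_sum S scalar_subringD) auto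
    qed
    moreover have "z = cls (\<Sum>k | coord p k \<noteq> 0. free_scalar (coord p k) * pbw_mono k)"
      using coord_expansion[of p] by (simp add: p quad_class_eq_iff)
    ultimately show "z \<in> generated_subalgebra K A {cls (x ^ n), cls (y ^ n)}" by simp
  qed
qed

end

section \<open>The centre for \<open>q = 1\<close> in characteristic 0\<close>

locale quad_coords_char_0 = quad_coords q1 q2 q3 q4 q a c d x y u
  for q1 q2 q3 q4 q a c d :: "'k::field_char_0" and x y u
begin

lemma center_weyl:
  assumes "a = 0" "q = 1" "c \<noteq> 0"
  shows "ring_center A = K"
proof (rule center_eq_scalarsI)
  fix p k assume p: "cls p \<in> ring_center A" and k: "coord p k \<noteq> 0"
  \<comment> \<open>For \<open>q = 1\<close> the shifted terms of \<open>zX\<close> and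
    \<open>Xz\<close> cancel. What is left is \<open>c (j + 1) m(i, j + 1) = 0\<close>, with
    \<open>j + 1\<close> invertible. The equation for \<open>Y\<close> is symmetric.\<close>
  have "coord p (i, Suc j) = 0" for i j
    using fun_cong[OF center_coord_right_x[OF p assms(1)], of "(i, j)"] assms
    by (simp add: right_x_def left_x_def qint_1_left of_nat_neq_0 del: of_nat_Suc split: if_splits)
  moreover have "coord p (Suc i, j) = 0" for i j
    using fun_cong[OF center_coord_right_y[OF p], of "(i, j)"] assms
    by (simp add: right_y_def left_y_def qint_1_left of_nat_neq_0 del: of_nat_Suc split: if_splits)
  ultimately show "k = (0, 0)"
    using k by (metis old.nat.exhaust surj_pair)
qed

text \<open>In Y-degree 0 nothing arrives from a lower degree, so \<open>Y\<close> multiplies the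
  entry \<open>(i, 0)\<close> by \<open>a i\<close>. This reflects
  \<open>Y X^i = X^i (Y + a i)\<close>.\<close>

lemma rep_y_power_boundary:
  assumes "q = 1" "c = 0"
  shows "rep u (y ^ j) f (i, 0) = (a * of_nat i) ^ j * f (i, 0)"
  by (induction j)
    (simp_all add: rep_1 rep_prod rep_y left_y_def assms qint_1_left)

lemma center_lie:
  assumes "q = 1" "c = 0" "a \<noteq> 0"
  shows "ring_center A = K"
proof (rule center_eq_scalarsI)
  fix p k assume p: "cls p \<in> ring_center A" and k: "coord p k \<noteq> 0"
  let ?m = "coord p"
  let ?B = "{k. ?m k \<noteq> 0}"
  \<comment> \<open>Comparing \<open>zY\<close> with \<open>Yz\<close> leaves
    \<open>a (i + 1) m(i + 1, j) = 0\<close>, so only powers of \<open>Y\<close> survive.\<close>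
  have "?m (Suc i, j) = 0" for i j
    using fun_cong[OF center_coord_right_y[OF p], of "(Suc i, j)"] assms
    by (simp add: right_y_def left_y_def qint_1_left of_nat_neq_0 del: of_nat_Suc split: if_splits)
  then have fst0: "fst k = 0" if "?m k \<noteq> 0" for k
    using that by (metis old.nat.exhaust surjective_pairing)
  define b where "b = (\<Sum>k\<in>?B. Polynomial.monom (?m k) (snd k))"
  \<comment> \<open>Here the element is \<open>b(Y)\<close>, and
    \<open>b(Y) X^i = X^i b(Y + a i)\<close>. Comparing the coefficients of \<open>X^i\<close> in
    \<open>z X^i = X^i z\<close> gives \<open>b(a i) = b(0)\<close>.\<close>
  have "poly b (a * of_nat i) = ?m (0, 0)" for i
  proof -
    have "rep u p (unit_vec (i, 0)) (i, 0)
        = rep u (\<Sum>k\<in>?B. free_scalar (?m k) * pbw_mono k) (unit_vec (i, 0)) (i, 0)"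
      using rep_quad_ideal[OF coord_expansion[of p]] by (simp add: rep_diff fun_eq_iff)
    also have "\<dots> = (\<Sum>k\<in>?B. ?m k * (a * of_nat i) ^ snd k)"
      unfolding rep_sum
    proof (rule sum.cong)
      fix k assume "k \<in> ?B"
      then have "pbw_mono k = y ^ snd k" using fst0 by (simp add: pbw_mono_def)
      then show "rep u (free_scalar (?m k) * pbw_mono k) (unit_vec (i, 0)) (i, 0)
          = ?m k * (a * of_nat i) ^ snd k"
        by (simp add: rep_prod rep_scalar rep_y_power_boundary assms unit_vec_def)
    qed simp
    also have "\<dots> = poly b (a * of_nat i)"
      by (simp add: b_def poly_sum poly_monom)
    finally have "poly b (a * of_nat i) = rep u p (unit_vec (i, 0)) (i, 0)" by simp
    \<comment> \<open>The array of \<open>X^i\<close> is \<open>x ^ i\<close> acting on that of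
      \<open>1\<close>. Centrality brings \<open>x ^ i\<close> to the left, where it merely shifts
      indices.\<close>
    also have "\<dots> = coord (p * x ^ i) (i, 0)"
      using rep_x_power[of i 0] by (simp add: coord_def rep_prod)
    also have "\<dots> = coord (x ^ i * p) (i, 0)"
      using p coord_cong[of "p * x ^ i" "x ^ i * p"] by (simp add: quad_class_center_iff)
    also have "\<dots> = ?m (0, 0)"
      by (induction i) (simp_all add: mult.assoc coord_mult_x left_x_def)
    finally show ?thesis .
  qed
  then have "range (\<lambda>i. a * of_nat i) \<subseteq> {t. poly (b - [:?m (0, 0):]) t = 0}"
    by auto
  moreover have "infinite (range (\<lambda>i. a * of_nat i :: 'k))"
    using assms by (intro range_inj_infinite) (auto simp: inj_def)
  ultimately have "infinite {t. poly (b - [:?m (0, 0):]) t = 0}"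
    using finite_subset by blast
  then have "b - [:?m (0, 0):] = 0" using poly_roots_finite by blast
  then have "b = [:?m (0, 0):]" by simp
  \<comment> \<open>All first exponents are 0, so distinct monomials have distinct second exponents
    and no coefficients of \<open>b\<close> merge.\<close>
  moreover have "Polynomial.coeff b (snd k) = ?m k"
  proof -
    have "Polynomial.coeff b (snd k) = (\<Sum>l\<in>?B. if l = k then ?m l else 0)"
      unfolding b_def coeff_sum
    proof (rule sum.cong)
      fix l assume "l \<in> ?B"
      then show "Polynomial.coeff (Polynomial.monom (?m l) (snd l)) (snd k) = (if l = k then ?m l else 0)"
        using fst0[of l] fst0[OF k] by (auto simp: prod_eq_iff)
    qed simp
    then show ?thesis using k finite_coord[of p] by simp
  qed
  ultimately have "snd k = 0"
    using k by (cases "snd k") (auto simp: coeff_pCons)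
  then show "k = (0, 0)" using fst0[OF k] by (simp add: prod_eq_iff)
qed

end


section \<open>Reduction of the coefficients\<close>

text \<open>Expanding \<open>(y - \<beta>)(x - \<alpha>) = q (x - \<alpha>)(y - \<beta>) + c\<close>
  gives these coefficients. Parametrizing by the shifts avoids division and keeps
  \<open>q = 1\<close> available.\<close>

lemma quad_coords_shift:
  fixes q \<alpha> \<beta> c :: "'k::field"
  shows "\<exists>u. quad_coords q ((1 - q) * \<beta>) ((1 - q) * \<alpha>) (c - (1 - q) * \<alpha> * \<beta>) q 0 c 1
    (free_var GenX - free_scalar \<alpha>) (free_var GenY - free_scalar \<beta>) u"
proof
  let ?u = "\<lambda>g f k. case g of GenX \<Rightarrow> left_x f k + \<alpha> * f k
    | GenY \<Rightarrow> left_y q 0 c f k + \<beta> * f k"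
  show "quad_coords q ((1 - q) * \<beta>) ((1 - q) * \<alpha>) (c - (1 - q) * \<alpha> * \<beta>) q 0 c 1
    (free_var GenX - free_scalar \<alpha>) (free_var GenY - free_scalar \<beta>) ?u"
  proof
    show "linear_op (?u g)" for g
      by (cases g) (auto simp: linear_op_def left_x_def left_y_def fun_eq_iff algebra_simps)
    fix S :: "(gen_xy, 'k) free_algebra set" and g
    assume S: "scalar_subring S" "free_var GenX - free_scalar \<alpha> \<in> S" "free_var GenY - free_scalar \<beta> \<in> S"
    have "free_var GenX - free_scalar \<alpha> + free_scalar \<alpha> \<in> S"
      "free_var GenY - free_scalar \<beta> + free_scalar \<beta> \<in> S"
      using S by (blast intro: scalar_subringD[OF S(1)])+
    then show "free_var g \<in> S" by (cases g) simp_all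
  next
    show "(free_var GenY - free_scalar \<beta>) * (free_var GenX - free_scalar \<alpha>)
        - (free_scalar q * ((free_var GenX - free_scalar \<alpha>) * (free_var GenY - free_scalar \<beta>))
          + free_scalar 0 * (free_var GenX - free_scalar \<alpha>) + free_scalar c)
      = free_scalar 1 * quad_relator q ((1 - q) * \<beta>) ((1 - q) * \<alpha>) (c - (1 - q) * \<alpha> * \<beta>)"
      by (simp add: quad_relator_def algebra_simps free_scalar_simps)
  qed (auto simp: fun_eq_iff rep_diff rep_var rep_scalar)
qed

text \<open>Modulo the relation, the new \<open>X\<close> is the commutator \<open>yx - xy\<close>.
  Since \<open>X\<close> is linear in \<open>x\<close> and \<open>y\<close>, one gets
  \<open>yX - Xy = q2 (yx - xy) = q2 X\<close>.\<close>

lemma quad_coords_lie_left: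
  fixes q2 q3 q4 :: "'k::field"
  assumes "q2 \<noteq> 0"
  shows "\<exists>u. quad_coords 1 q2 q3 q4 1 q2 0 q2
    (free_scalar q2 * free_var GenX + free_scalar q3 * free_var GenY + free_scalar q4) (free_var GenY) u"
    (is "\<exists>u. quad_coords _ _ _ _ _ _ _ _ ?x _ u")
proof
  \<comment> \<open>The operator for \<open>x\<close> solves \<open>X = q2 x + q3 y + q4\<close> for
    \<open>x\<close>.\<close>
  let ?u = "\<lambda>g f k. case g of
      GenX \<Rightarrow> inverse q2 * (left_x f k - q3 * left_y 1 q2 0 f k - q4 * f k)
    | GenY \<Rightarrow> left_y 1 q2 0 f k"
  have lin: "linear_op (?u g)" for g
    by (cases g) (auto simp: linear_op_def left_x_def left_y_def fun_eq_iff algebra_simps)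
  show "quad_coords 1 q2 q3 q4 1 q2 0 q2 ?x (free_var GenY) ?u"
  proof
    show "linear_op (?u g)" for g by (rule lin)
    show "rep ?u ?x = left_x"
      using assms by (simp add: fun_eq_iff rep_add rep_mult[OF lin] rep_var rep_scalar flip: mult.assoc)
    show "rep ?u (free_var GenY) = left_y 1 q2 0" by (simp add: fun_eq_iff rep_var)
    fix S :: "(gen_xy, 'k) free_algebra set" and g
    assume S: "scalar_subring S" "?x \<in> S" "free_var GenY \<in> S"
    have "free_scalar (inverse q2) * (?x - free_scalar q3 * free_var GenY - free_scalar q4) \<in> S"
      using S by (blast intro: scalar_subringD[OF S(1)] scalar_subring_diff[OF S(1)])
    moreover have "free_scalar (inverse q2) * (?x - free_scalar q3 * free_var GenY - free_scalar q4)
        = free_var GenX"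
      using assms by (simp flip: mult.assoc free_scalar_mult)
    ultimately show "free_var g \<in> S" using S(3) by (cases g) simp_all
  next
    show "free_var GenY * ?x - (free_scalar 1 * (?x * free_var GenY) + free_scalar q2 * ?x + free_scalar 0)
      = free_scalar q2 * quad_relator 1 q2 q3 q4"
      by (simp add: quad_relator_def algebra_simps free_scalar_simps)
  qed (use assms in auto)
qed

text \<open>The commutator is now \<open>X = q3 y + q4\<close>, and \<open>x\<close> takes the role
  of \<open>Y\<close>. The exchanged order produces the sign:
  \<open>xX - Xx = - q3 X\<close>.\<close>

lemma quad_coords_lie_right:
  fixes q3 q4 :: "'k::field"
  assumes "q3 \<noteq> 0"
  shows "\<exists>u. quad_coords 1 0 q3 q4 1 (- q3) 0 (- q3)
    (free_scalar q3 * free_var GenY + free_scalar q4) (free_var GenX) u"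
    (is "\<exists>u. quad_coords _ _ _ _ _ _ _ _ ?x _ u")
proof
  let ?u = "\<lambda>g f k. case g of
      GenX \<Rightarrow> left_y 1 (- q3) 0 f k
    | GenY \<Rightarrow> inverse q3 * (left_x f k - q4 * f k)"
  have lin: "linear_op (?u g)" for g
    by (cases g) (auto simp: linear_op_def left_x_def left_y_def fun_eq_iff algebra_simps)
  show "quad_coords 1 0 q3 q4 1 (- q3) 0 (- q3) ?x (free_var GenX) ?u"
  proof
    show "linear_op (?u g)" for g by (rule lin)
    show "rep ?u ?x = left_x"
      using assms by (simp add: fun_eq_iff rep_add rep_mult[OF lin] rep_var rep_scalar flip: mult.assoc)
    show "rep ?u (free_var GenX) = left_y 1 (- q3) 0" by (simp add: fun_eq_iff rep_var)
    fix S :: "(gen_xy, 'k) free_algebra set" and g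
    assume S: "scalar_subring S" "?x \<in> S" "free_var GenX \<in> S"
    have "free_scalar (inverse q3) * (?x - free_scalar q4) \<in> S"
      using S by (blast intro: scalar_subringD[OF S(1)] scalar_subring_diff[OF S(1)])
    moreover have "free_scalar (inverse q3) * (?x - free_scalar q4) = free_var GenY"
      using assms by (simp flip: mult.assoc free_scalar_mult)
    ultimately show "free_var g \<in> S" using S(3) by (cases g) simp_all
  next
    show "free_var GenX * ?x - (free_scalar 1 * (?x * free_var GenX) + free_scalar (- q3) * ?x + free_scalar 0)
      = free_scalar (- q3) * quad_relator 1 0 q3 q4"
      by (simp add: quad_relator_def algebra_simps free_scalar_simps)
  qed (use assms in auto)
qed


section \<open>Evaluation of polynomials\<close>

text \<open>A lift of \<open>eval_poly_in\<close> to the free algebra, so that identities can be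
  proved before passing to classes.\<close>

definition free_eval :: "'k Polynomial.poly \<Rightarrow> ('g, 'k) free_algebra \<Rightarrow> ('g, 'k::field) free_algebra"
  where "free_eval f p = (\<Sum>i\<le>Polynomial.degree f. free_scalar (Polynomial.coeff f i) * p ^ i)"

lemma free_eval_altdef:
  assumes "Polynomial.degree f \<le> N"
  shows "free_eval f p = (\<Sum>i\<le>N. free_scalar (Polynomial.coeff f i) * p ^ i)"
  unfolding free_eval_def
  using assms by (intro sum.mono_neutral_left) (auto simp: coeff_eq_0)

lemma free_eval_add: "free_eval (f + g) p = free_eval f p + free_eval g p"
proof -
  let ?N = "max (Polynomial.degree f) (Polynomial.degree g)"
  have "free_eval (f + g) p = (\<Sum>i\<le>?N. free_scalar (Polynomial.coeff (f + g) i) * p ^ i)"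
    by (rule free_eval_altdef[OF degree_add_le_max])
  also have "\<dots> = free_eval f p + free_eval g p"
    by (simp add: free_eval_altdef[of f ?N] free_eval_altdef[of g ?N] free_scalar_add distrib_right
        sum.distrib)
  finally show ?thesis .
qed

text \<open>The product splits into the multiple by \<open>- b\<close> and the shift
  \<open>pCons 0 f\<close>. Scalars commute with \<open>p\<close>, so the shift is multiplication by
  \<open>p\<close>.\<close>

lemma free_eval_linear_mult:
  "free_eval ([:- b, 1:] * f) p = (p - free_scalar b) * free_eval f p"
proof -
  let ?N = "Polynomial.degree f"
  have 1: "free_eval (Polynomial.smult (- b) f) p = - free_scalar b * free_eval f p"
    by (subst free_eval_altdef[of _ ?N])
      (simp_all add: free_eval_def sum_distrib_left free_scalar_uminus free_scalar_mult mult.assoc sum_negf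
        degree_smult_le)
  have 2: "free_eval (pCons 0 f) p = p * free_eval f p"
    by (subst free_eval_altdef[of _ "Suc ?N"])
      (simp_all add: sum.atMost_Suc_shift free_eval_def sum_distrib_left free_scalar_left_commute
        degree_pCons_le del: sum.atMost_Suc)
  have "[:- b, 1:] * f = Polynomial.smult (- b) f + pCons 0 f" by simp
  then show ?thesis by (simp only: free_eval_add 1 2) (simp add: algebra_simps)
qed

lemma free_eval_linear_power: "free_eval ([:- b, 1:] ^ n) p = (p - free_scalar b) ^ n"
proof (induction n)
  case (Suc n)
  then show ?case by (simp only: power_Suc free_eval_linear_mult)
qed (simp add: free_eval_def)

lemma (in quad) eval_poly_in_class:
  "eval_poly_in A (quad_scalar q1 q2 q3 q4) f (cls p) = cls (free_eval f p)"
  by (simp add: eval_poly_in_def free_eval_def quad_scalar_def quad_class_sum quad_class_mult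
      quad_class_power)

section \<open>Combination of the cases\<close>

theorem theorem2p2:
  fixes q1 q2 q3 q4 :: "'k::field_char_0"
  defines "A \<equiv> quad_algebra q1 q2 q3 q4"
    and "x \<equiv> quad_x q1 q2 q3 q4"
    and "y \<equiv> quad_y q1 q2 q3 q4"
    and "\<iota> \<equiv> quad_scalar q1 q2 q3 q4"
  defines "K \<equiv> range \<iota>"
  assumes "q1 \<noteq> 0"
  shows
    "(q2 = 0 \<and> q3 = 0 \<longrightarrow>
       (\<not> root_of_unity q1 \<or> (q1 = 1 \<and> q4 \<noteq> 0) \<longrightarrow> ring_center A = K) \<and>
       (\<forall>n. n \<ge> 2 \<and> primitive_root_of_unity n q1 \<longrightarrow>
          ring_center A = generated_subalgebra K A {x [^]\<^bsub>A\<^esub> n, y [^]\<^bsub>A\<^esub> n})) \<and>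
     (q2 \<noteq> 0 \<or> q3 \<noteq> 0 \<longrightarrow>
       (\<not> root_of_unity q1 \<or> q1 = 1 \<longrightarrow> ring_center A = K) \<and>
       (\<forall>n. n \<ge> 2 \<and> primitive_root_of_unity n q1 \<longrightarrow>
          (\<exists>f g :: 'k Polynomial.poly.
             Polynomial.degree f = n \<and> Polynomial.degree g = n \<and>
             ring_center A =
               generated_subalgebra K A {eval_poly_in A \<iota> f x, eval_poly_in A \<iota> g y})))"
proof -
  interpret quad q1 q2 q3 q4 .
  have neq_1: "q1 \<noteq> 1" if "\<not> root_of_unity q1 \<or> primitive_root_of_unity n q1 \<and> n \<ge> 2" for n
  proof
    assume "q1 = 1"
    then have "root_of_unity q1" "q1 ^ 1 = 1" by (auto simp: root_of_unity_def)
    then show False using that by (auto simp: primitive_root_of_unity_def)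
  qed
  \<comment> \<open>The last clause ensures that for \<open>q2 = q3 = 0\<close> the generators are
    \<open>x\<close> and \<open>y\<close> themselves, as part (i) demands.\<close>
  have shift: "\<exists>\<alpha> \<beta> c u. quad_coords q1 q2 q3 q4 q1 0 c 1
      (free_var GenX - free_scalar \<alpha>) (free_var GenY - free_scalar \<beta>) u \<and>
      (q2 = 0 \<and> q3 = 0 \<longrightarrow> \<alpha> = 0 \<and> \<beta> = 0)" if "q1 \<noteq> 1"
  proof -
    \<comment> \<open>These solve \<open>q3 = (1 - q1) \<alpha>\<close> and
      \<open>q2 = (1 - q1) \<beta>\<close>; the constant \<open>c\<close> is then chosen to restore
      \<open>q4\<close>.\<close>
    let ?\<alpha> = "q3 / (1 - q1)" and ?\<beta> = "q2 / (1 - q1)"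
    show ?thesis
      using quad_coords_shift[of q1 ?\<beta> ?\<alpha> "q4 + (1 - q1) * ?\<alpha> * ?\<beta>"] that
      by (intro exI[of _ ?\<alpha>] exI[of _ ?\<beta>] exI[of _ "q4 + (1 - q1) * ?\<alpha> * ?\<beta>"]) simp
  qed
  have not_root: "ring_center A = K" if q1: "\<not> root_of_unity q1"
  proof -
    obtain \<alpha> \<beta> c u where "quad_coords q1 q2 q3 q4 q1 0 c 1
        (free_var GenX - free_scalar \<alpha>) (free_var GenY - free_scalar \<beta>) u"
      using shift[OF neq_1[of 0]] q1 by blast
    then show ?thesis
      unfolding A_def K_def \<iota>_def
      using quad_coords.center_not_root_of_unity[OF _ refl q1] by blast
  qed
  have root: "\<exists>\<alpha> \<beta>. (q2 = 0 \<and> q3 = 0 \<longrightarrow> \<alpha> = 0 \<and> \<beta> = 0) \<and>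
      ring_center A = generated_subalgebra K A
        {cls ((free_var GenX - free_scalar \<alpha>) ^ n), cls ((free_var GenY - free_scalar \<beta>) ^ n)}"
    if n: "n \<ge> 2" "primitive_root_of_unity n q1" for n
  proof -
    obtain \<alpha> \<beta> c u where "quad_coords q1 q2 q3 q4 q1 0 c 1
        (free_var GenX - free_scalar \<alpha>) (free_var GenY - free_scalar \<beta>) u"
      and "q2 = 0 \<and> q3 = 0 \<longrightarrow> \<alpha> = 0 \<and> \<beta> = 0"
      using shift[OF neq_1[of n]] n by blast
    then show ?thesis
      unfolding A_def K_def \<iota>_def
      using quad_coords.center_primitive_root[OF _ refl n(2,1)] by blast
  qed
  have weyl: "ring_center A = K" if "q2 = 0" "q3 = 0" "q1 = 1" "q4 \<noteq> 0"
  proof -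
    \<comment> \<open>The zero shift, for which \<open>c\<close> equals \<open>q4\<close>.\<close>
    obtain u where "quad_coords 1 0 0 q4 1 0 q4 1
        (free_var GenX - free_scalar 0) (free_var GenY - free_scalar 0) u"
      using quad_coords_shift[of 1 0 0 q4] by auto
    then show ?thesis
      unfolding A_def K_def \<iota>_def that
      using quad_coords_char_0.center_weyl[OF quad_coords_char_0.intro] that(4) by blast
  qed
  have lie: "ring_center A = K" if "q2 \<noteq> 0 \<or> q3 \<noteq> 0" "q1 = 1"
  proof (cases "q2 = 0")
    case True
    then have q3: "q3 \<noteq> 0" using that by simp
    obtain u where "quad_coords 1 q2 q3 q4 1 (- q3) 0 (- q3)
        (free_scalar q3 * free_var GenY + free_scalar q4) (free_var GenX) u"
      using quad_coords_lie_right[OF q3, of q4] True by auto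
    then show ?thesis
      unfolding A_def K_def \<iota>_def that(2)
      using quad_coords_char_0.center_lie[OF quad_coords_char_0.intro] q3 by fastforce
  next
    case False
    then obtain u where "quad_coords 1 q2 q3 q4 1 q2 0 q2
        (free_scalar q2 * free_var GenX + free_scalar q3 * free_var GenY + free_scalar q4)
        (free_var GenY) u"
      using quad_coords_lie_left[of q2 q3 q4] by auto
    then show ?thesis
      unfolding A_def K_def \<iota>_def that(2)
      using quad_coords_char_0.center_lie[OF quad_coords_char_0.intro] False by blast
  qed
  have "ring_center A = generated_subalgebra K A {x [^]\<^bsub>A\<^esub> n, y [^]\<^bsub>A\<^esub> n}"
    if "q2 = 0 \<and> q3 = 0" "n \<ge> 2" "primitive_root_of_unity n q1" for n
  proof -
    have "ring_center A = generated_subalgebra K A {cls (free_var GenX ^ n), cls (free_var GenY ^ n)}"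
      using root[OF that(2,3)] that(1) by auto
    then show ?thesis
      by (simp add: A_def x_def y_def quad_x_def quad_y_def quad_class_power)
  qed
  moreover have "\<exists>f g. Polynomial.degree f = n \<and> Polynomial.degree g = n \<and>
      ring_center A = generated_subalgebra K A {eval_poly_in A \<iota> f x, eval_poly_in A \<iota> g y}"
    if n: "n \<ge> 2" "primitive_root_of_unity n q1" for n
  proof -
    obtain \<alpha> \<beta> where "ring_center A = generated_subalgebra K A
        {cls ((free_var GenX - free_scalar \<alpha>) ^ n), cls ((free_var GenY - free_scalar \<beta>) ^ n)}"
      using root[OF n] by blast
    \<comment> \<open>The witnesses are \<open>f = (t - \<alpha>)^n\<close> and
      \<open>g = (t - \<beta>)^n\<close>, whose values at \<open>x\<close> and \<open>y\<close> are
      the powers of the shifted generators.\<close>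
    then have "ring_center A = generated_subalgebra K A
        {eval_poly_in A \<iota> ([:- \<alpha>, 1:] ^ n) x, eval_poly_in A \<iota> ([:- \<beta>, 1:] ^ n) y}"
      unfolding A_def \<iota>_def x_def y_def quad_x_def quad_y_def eval_poly_in_class
        free_eval_linear_power .
    then show ?thesis using degree_linear_power by blast
  qed
  ultimately show ?thesis using not_root weyl lie by blast
qed

end
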